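(* Let $H$ be a finite simple graph. Then $H$ is realizable if and only if there exists a clique cover $\{\kappa_1,\dots,\kappa_n\}$ of $H$ such that the polynomial system in the variables $(m_{ij})_{i,j\in[n]}$ $$\forall\, W\subseteq[n],\qquad \sum_{\sigma\in\mathrm{Cyc}_W}\ \prod_{v\in W} m_{v,\sigma(v)} \;=\; \big|\mathcal{K}_W\big|,\qquad \mathcal{K}_W:=\bigcap_{v\in W}\kappa_v\setminus\bigcup_{v\in[n]\setminus W}\kappa_v,$$ admits a solution in nonnegative integers. In that case, $H$ is realized by the directed multigraph $G$ with vertex set $[n]$ whose adjacency matrix $\mathbf{A}$ is given by $\mathbf{A}_{i,j}=m_{i,j}$ for $1\le i,j\le n$.
   Context: A directed multigraph $G$ has a finite vertex set and a finite multiset of arcs (loops and multiple arcs allowed); its adjacency matrix $\mathbf{A}$ has $\mathbf{A}_{i,j}$ equal to the number of arcs from $i$ to $j$. A simple cycle of $G$ is a closed sequence of arcs $(i_0,i_1)_{k_1}\cdots(i_{\ell-1},i_0)_{k_\ell}$, $\ell\ge1$, with all $i_t$ distinct, considered up to cyclic rotation (orientation and the specific arcs used matter; a self-loop is a simple cycle of length one). The hike dependency graph $\phi(G)$ is the simple graph whose vertices are the simple cycles of $G$, two distinct simple cycles being adjacent iff they share a vertex of $G$. A finite simple graph $H$ is realizable if $H\cong\phi(G)$ for some directed multigraph $G$, and $G$ then realizes $H$. A clique cover of $H$ is a finite family of cliques (complete subgraphs, identified with their vertex sets) of $H$ such that every vertex and every edge of $H$ lies in at least one of them. For a finite set $S$,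 $\mathrm{Cyc}_S$ denotes the set of permutations of $S$ consisting of a single cycle (cyclic permutations of $S$; for $|S|=1$ this is the identity). For $W=\emptyset$ the equation is the trivial equation $0=0$. *)

theory Defs
  imports "Graph_Theory.Graph_Theory" "HOL-Combinatorics.Orbits"
begin

text \<open>
  A directed multigraph is a \<^locale>\<open>fin_digraph\<close>: finitely many vertices and finitely many
  individually named arcs, with loops and parallel arcs allowed.  A finite simple graph is a
  \<^locale>\<open>pair_graph\<close>: a finite, loop-free, symmetric set of vertex pairs, each undirected edge
  being represented by its two orientations.
\<close>

definition adj_matrix :: "('v, 'e) pre_digraph \<Rightarrow> 'v \<Rightarrow> 'v \<Rightarrow> nat" where
  "adj_matrix G i j = card {e \<in> arcs G. tail G e = i \<and> head G e = j}"

text \<open>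
  A simple cycle is the class of an arc list satisfying the library predicate
  \<^const>\<open>pre_digraph.cycle\<close> (nonempty, closed, no repeated vertex) under cyclic rotation.
\<close>

definition rotations :: "'e list \<Rightarrow> 'e list set" where
  "rotations p = range (\<lambda>k. rotate k p)"

definition simple_cycles :: "('v, 'e) pre_digraph \<Rightarrow> 'e list set set" where
  "simple_cycles G = {rotations p | p. pre_digraph.cycle G p}"

definition cycle_verts :: "('v, 'e) pre_digraph \<Rightarrow> 'e list set \<Rightarrow> 'v set" where
  "cycle_verts G C = (\<Union>p\<in>C. tail G ` set p)"

definition hike_dependency_graph :: "('v, 'e) pre_digraph \<Rightarrow> 'e list set pair_pre_digraph" where
  "hike_dependency_graph G =
    \<lparr>pverts = simple_cycles G,
     parcs = {(C, D). C \<in> simple_cycles G \<and> D \<in> simple_cycles G \<and> C \<noteq> D \<and>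
                      cycle_verts G C \<inter> cycle_verts G D \<noteq> {}}\<rparr>"

definition realizes :: "('v, 'e) pre_digraph \<Rightarrow> 'a pair_pre_digraph \<Rightarrow> bool" where
  "realizes G H \<longleftrightarrow>
    fin_digraph G \<and> digraph_iso (with_proj (hike_dependency_graph G)) (with_proj H)"

text \<open>
  The quantifier cannot range over types; vertices and arcs named by natural numbers suffice, as
  lemma \<open>realizes_imp_realizable\<close> below confirms.
\<close>

definition realizable :: "'a pair_pre_digraph \<Rightarrow> bool" where
  "realizable H \<longleftrightarrow> (\<exists>G :: (nat, nat) pre_digraph. realizes G H)"

definition clique :: "'a pair_pre_digraph \<Rightarrow> 'a set \<Rightarrow> bool" where
  "clique H K \<longleftrightarrow> K \<subseteq> pverts H \<and> (\<forall>u\<in>K. \<forall>v\<in>K. u \<noteq> v \<longrightarrow> (u, v) \<in> parcs H)"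

text \<open>
  The family is indexed, so a clique may occur several times; only the values of \<open>\<kappa>\<close> on
  \<open>{1..n}\<close> matter.
\<close>

definition clique_cover :: "'a pair_pre_digraph \<Rightarrow> nat \<Rightarrow> (nat \<Rightarrow> 'a set) \<Rightarrow> bool" where
  "clique_cover H n \<kappa> \<longleftrightarrow>
    (\<forall>i\<in>{1..n}. clique H (\<kappa> i)) \<and>
    (\<forall>v\<in>pverts H. \<exists>i\<in>{1..n}. v \<in> \<kappa> i) \<and>
    (\<forall>(u, v)\<in>parcs H. \<exists>i\<in>{1..n}. u \<in> \<kappa> i \<and> v \<in> \<kappa> i)"

definition Cyc :: "'b set \<Rightarrow> ('b \<Rightarrow> 'b) set" where
  "Cyc S = {\<sigma>. \<sigma> permutes S \<and> cyclic_on \<sigma> S}"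

text \<open>
  The intersection is taken inside the vertex set of \<open>H\<close>; this only matters for \<open>W = {}\<close>, where
  the class of a clique cover is then empty.  As also \<open>Cyc {} = {}\<close>, the equation for \<open>W = {}\<close>
  reads \<open>0 = 0\<close>.
\<close>

definition clique_class ::
  "'a pair_pre_digraph \<Rightarrow> nat \<Rightarrow> (nat \<Rightarrow> 'a set) \<Rightarrow> nat set \<Rightarrow> 'a set" where
  "clique_class H n \<kappa> W = (pverts H \<inter> (\<Inter>v\<in>W. \<kappa> v)) - (\<Union>v\<in>{1..n} - W. \<kappa> v)"

definition cycle_system_solution ::
  "'a pair_pre_digraph \<Rightarrow> nat \<Rightarrow> (nat \<Rightarrow> 'a set) \<Rightarrow> (nat \<Rightarrow> nat \<Rightarrow> nat) \<Rightarrow> bool" where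
  "cycle_system_solution H n \<kappa> m \<longleftrightarrow>
    (\<forall>W. W \<subseteq> {1..n} \<longrightarrow>
      (\<Sum>\<sigma>\<in>Cyc W. \<Prod>v\<in>W. m v (\<sigma> v)) = card (clique_class H n \<kappa> W))"


lemma Cyc_empty: "Cyc {} = {}"
  by (simp add: Cyc_def cyclic_on_def)

lemma Cyc_singleton: "Cyc {x} = {id}"
proof -
  have "cyclic_on id {x}"
    by (auto simp: cyclic_on_def orbit_altdef)
  then show ?thesis
    by (auto simp: Cyc_def permutes_sing)
qed

lemma clique_class_empty: "clique_cover H n \<kappa> \<Longrightarrow> clique_class H n \<kappa> {} = {}"
  by (auto simp: clique_cover_def clique_class_def)

lemma pair_wf_digraph_hike: "pair_wf_digraph (hike_dependency_graph G)"
  by unfold_locales (auto simp: hike_dependency_graph_def)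

lemma digraph_iso_with_proj_iff:
  assumes "pair_wf_digraph A" "pair_wf_digraph B"
  shows "digraph_iso (with_proj A) (with_proj B) \<longleftrightarrow>
    (\<exists>f. bij_betw f (pverts A) (pverts B) \<and>
      (\<forall>u\<in>pverts A. \<forall>v\<in>pverts A. (u, v) \<in> parcs A \<longleftrightarrow> (f u, f v) \<in> parcs B))"
    (is "?L \<longleftrightarrow> ?R")
proof -
  interpret A: pair_wf_digraph A by fact
  interpret B: pair_wf_digraph B by fact
  show ?thesis
  proof
    assume ?L
    then obtain h where h: "pre_digraph.digraph_isomorphism (with_proj A) h"
      and B: "with_proj B = app_iso h (with_proj A)"
      by (auto simp: digraph_iso_def)
    have vB: "pverts B = iso_verts h ` pverts A"
      using arg_cong[OF B, of verts] by simp
    have inj: "inj_on (iso_verts h) (pverts A)"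
      using h by (simp add: pre_digraph.digraph_isomorphism_def)
    have eB: "parcs B = (\<lambda>(u, v). (iso_verts h u, iso_verts h v)) ` parcs A"
      using arg_cong[OF B, of arcs_ends] A.arcs_ends_app_iso_eq[OF h] by simp
    show ?R
    proof (intro exI[of _ "iso_verts h"] conjI ballI)
      show "bij_betw (iso_verts h) (pverts A) (pverts B)"
        using inj vB by (simp add: bij_betw_def)
      fix u v assume "u \<in> pverts A" "v \<in> pverts A"
      then show "(u, v) \<in> parcs A \<longleftrightarrow> (iso_verts h u, iso_verts h v) \<in> parcs B"
        using inj by (auto simp: eB dest: inj_onD A.in_arcsD1 A.in_arcsD2 intro: rev_image_eqI)
    qed
  next
    assume ?R
    then obtain f where f: "bij_betw f (pverts A) (pverts B)"
      and e: "\<And>u v. u \<in> pverts A \<Longrightarrow> v \<in> pverts A \<Longrightarrow> (u, v) \<in> parcs A \<longleftrightarrow> (f u, f v) \<in> parcs B"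
      by blast
    define h where "h = \<lparr>iso_verts = f, iso_arcs = map_prod f f, iso_head = snd, iso_tail = fst\<rparr>"
    have inj: "inj_on f (pverts A)" and im: "f ` pverts A = pverts B"
      using f by (auto simp: bij_betw_def)
    have "inj_on (map_prod f f) (parcs A)"
      by (rule inj_on_subset[OF map_prod_inj_on[OF inj inj]]) (auto dest: A.in_arcsD1 A.in_arcsD2)
    then have "pre_digraph.digraph_isomorphism (with_proj A) h"
      using inj A.wf_digraph unfolding pre_digraph.digraph_isomorphism_def h_def by simp
    moreover have "map_prod f f ` parcs A = parcs B"
    proof (intro equalityI subsetI)
      fix x assume "x \<in> map_prod f f ` parcs A"
      then obtain u v where "x = (f u, f v)" "(u, v) \<in> parcs A"
        by auto
      then show "x \<in> parcs B"
        using e[of u v] A.in_arcsD1[of u v] A.in_arcsD2[of u v] by simp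
    next
      fix x assume x: "x \<in> parcs B"
      then obtain u v where "x = (f u, f v)" "u \<in> pverts A" "v \<in> pverts A"
        using im B.arc_fst_in_verts[OF x] B.arc_snd_in_verts[OF x]
        by (metis imageE prod.collapse)
      then show "x \<in> map_prod f f ` parcs A"
        using x e[of u v] by (intro image_eqI[of _ _ "(u, v)"]) simp_all
    qed
    then have "with_proj B = app_iso h (with_proj A)"
      using im by (simp add: app_iso_def with_proj_def h_def)
    ultimately show ?L
      by (auto simp: digraph_iso_def)
  qed
qed

lemma ex_digraph_adj_matrix:
  fixes n :: nat and m :: "nat \<Rightarrow> nat \<Rightarrow> nat"
  shows "\<exists>G :: (nat, nat \<times> nat \<times> nat) pre_digraph. fin_digraph G \<and> verts G = {1..n} \<and>
    (\<forall>i\<in>{1..n}. \<forall>j\<in>{1..n}. adj_matrix G i j = m i j)"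
proof -
  define A where "A = (SIGMA i:{1..n}. SIGMA j:{1..n}. {..<m i j})"
  define G :: "(nat, nat \<times> nat \<times> nat) pre_digraph"
    where "G = \<lparr>verts = {1..n}, arcs = A, tail = fst, head = fst \<circ> snd\<rparr>"
  have "finite A" by (auto simp: A_def)
  then have "fin_digraph G"
    by unfold_locales (auto simp: G_def A_def)
  moreover have "adj_matrix G i j = m i j" if "i \<in> {1..n}" "j \<in> {1..n}" for i j
  proof -
    have "{e \<in> arcs G. tail G e = i \<and> head G e = j} = (\<lambda>k. (i, j, k)) ` {..<m i j}"
      using that by (auto simp: G_def A_def)
    then show ?thesis
      by (simp add: adj_matrix_def card_image inj_on_def)
  qed
  ultimately show ?thesis
    by (intro exI[of _ G]) (simp add: G_def)
qed


lemma rotations_map: "rotations (map f p) = map f ` rotations p"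
  by (auto simp: rotations_def rotate_map)

lemma simple_cycles_subset:
  assumes "C \<in> simple_cycles G"
  shows "C \<subseteq> lists (arcs G)"
  using assms
  by (auto simp: simple_cycles_def rotations_def pre_digraph.cycle_def pre_digraph.awalk_def)

context wf_digraph
begin

lemma cycle_app_iso:
  assumes hom: "digraph_isomorphism hom" and "cycle p"
  shows "pre_digraph.cycle (app_iso hom G) (map (iso_arcs hom) p)"
proof -
  from \<open>cycle p\<close> obtain u where
    u: "awalk u p u" "distinct (tl (awalk_verts u p))" "p \<noteq> []"
    by (auto simp: cycle_def)
  have "set (tl (awalk_verts u p)) \<subseteq> verts G"
    using awalk_verts_in_verts[of u p] u(1)
    by (metis awalk_def list.set_sel(2) subsetI tl_Nil)
  then have "inj_on (iso_verts hom) (set (tl (awalk_verts u p)))"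
    using digraph_isomorphism_inj_on_verts[OF hom] by (blast intro: inj_on_subset)
  then show ?thesis
    using u awalk_app_isoI[OF u(1) hom] awalk_verts_app_iso_eq[OF hom u(1)]
    unfolding pre_digraph.cycle_def
    by (intro exI[of _ "iso_verts hom u"]) (simp add: map_tl[symmetric] distinct_map)
qed

lemma simple_cycles_app_iso:
  assumes hom: "digraph_isomorphism hom"
  shows "simple_cycles (app_iso hom G) = (`) (map (iso_arcs hom)) ` simple_cycles G"
proof (intro equalityI subsetI)
  fix C assume "C \<in> simple_cycles (app_iso hom G)"
  then obtain q where C: "C = rotations q" and q: "pre_digraph.cycle (app_iso hom G) q"
    by (auto simp: simple_cycles_def)
  interpret G': wf_digraph "app_iso hom G"
    using hom by (rule wf_digraphI_app_iso)
  define p where "p = map (iso_arcs (inv_iso hom)) q"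
  have "cycle p"
    using G'.cycle_app_iso[OF digraph_isomorphism_invI[OF hom] q] hom by (simp add: p_def)
  moreover have "set q \<subseteq> arcs (app_iso hom G)"
    using q by (auto simp: pre_digraph.cycle_def pre_digraph.awalk_def)
  then have "map (iso_arcs hom) p = q"
    unfolding p_def map_map o_def
    by (intro map_idI iso_arcs_iso_inv[OF hom]) blast
  ultimately show "C \<in> (`) (map (iso_arcs hom)) ` simple_cycles G"
    using C by (intro image_eqI[of _ _ "rotations p"])
      (auto simp: simple_cycles_def rotations_map[symmetric])
next
  fix C assume "C \<in> (`) (map (iso_arcs hom)) ` simple_cycles G"
  then obtain p where "cycle p" "C = rotations (map (iso_arcs hom) p)"
    by (auto simp: simple_cycles_def rotations_map)
  then show "C \<in> simple_cycles (app_iso hom G)"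
    unfolding simple_cycles_def using cycle_app_iso[OF hom] by blast
qed

lemma cycle_verts_app_iso:
  assumes hom: "digraph_isomorphism hom" and C: "C \<in> simple_cycles G"
  shows "cycle_verts (app_iso hom G) (map (iso_arcs hom) ` C) = iso_verts hom ` cycle_verts G C"
proof -
  have "(\<lambda>e. iso_tail hom (iso_arcs hom e)) ` set p = (\<lambda>e. iso_verts hom (tail G e)) ` set p"
    if "p \<in> C" for p
    using simple_cycles_subset[OF C] that
    by (intro image_cong refl iso_verts_tail[OF hom]) auto
  then show ?thesis
    by (simp add: cycle_verts_def image_UN image_image)
qed

lemma cycle_verts_in_verts:
  assumes "C \<in> simple_cycles G"
  shows "cycle_verts G C \<subseteq> verts G"
  using simple_cycles_subset[OF assms] by (auto simp: cycle_verts_def)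

lemma hike_app_iso:
  assumes hom: "digraph_isomorphism hom"
  shows "digraph_iso (with_proj (hike_dependency_graph (app_iso hom G)))
    (with_proj (hike_dependency_graph G))"
proof -
  let ?F = "(`) (map (iso_arcs hom))" and ?G = "app_iso hom G"
  let ?A = "with_proj (hike_dependency_graph G)"
  have injL: "inj_on (map (iso_arcs hom)) (lists (arcs G))"
    using digraph_isomorphism_inj_on_arcs[OF hom] by (rule inj_on_mapI[OF inj_on_subset]) auto
  have inj: "inj_on ?F (simple_cycles G)"
  proof (rule inj_onI)
    fix C D assume "C \<in> simple_cycles G" "D \<in> simple_cycles G" "?F C = ?F D"
    then show "C = D"
      using inj_on_image_eq_iff[OF injL simple_cycles_subset simple_cycles_subset] by blast
  qed
  have bij: "bij_betw ?F (pverts (hike_dependency_graph G)) (pverts (hike_dependency_graph ?G))"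
    using inj by (simp add: hike_dependency_graph_def bij_betw_def simple_cycles_app_iso[OF hom])
  have meet: "cycle_verts ?G (?F C) \<inter> cycle_verts ?G (?F D) = {} \<longleftrightarrow>
      cycle_verts G C \<inter> cycle_verts G D = {}"
    if "C \<in> simple_cycles G" "D \<in> simple_cycles G" for C D
    using that cycle_verts_in_verts digraph_isomorphism_inj_on_verts[OF hom]
    by (simp add: cycle_verts_app_iso[OF hom] flip: inj_on_image_Int[of _ "verts G"])
  have edges: "(C, D) \<in> parcs (hike_dependency_graph G) \<longleftrightarrow>
      (?F C, ?F D) \<in> parcs (hike_dependency_graph ?G)"
    if "C \<in> simple_cycles G" "D \<in> simple_cycles G" for C D
    using that meet[OF that] inj_on_eq_iff[OF inj that]
    by (simp add: hike_dependency_graph_def simple_cycles_app_iso[OF hom])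
  have iso: "digraph_iso ?A (with_proj (hike_dependency_graph ?G))"
    unfolding digraph_iso_with_proj_iff[OF pair_wf_digraph_hike pair_wf_digraph_hike]
    using bij edges by (intro exI[of _ ?F]) (simp add: hike_dependency_graph_def)
  have wf: "wf_digraph ?A"
    by (simp add: wf_digraph_wp_iff pair_wf_digraph_hike)
  from iso obtain h where h: "pre_digraph.digraph_isomorphism ?A h"
    and eq: "with_proj (hike_dependency_graph ?G) = app_iso h ?A"
    by (auto simp: digraph_iso_def)
  show ?thesis
    unfolding digraph_iso_def eq
    using wf_digraph.digraph_isomorphism_invI[OF wf h] pre_digraph.app_iso_inv[OF h] by metis
qed

end

lemma digraph_iso_trans_pair:
  assumes "pair_wf_digraph A" "pair_wf_digraph B" "pair_wf_digraph C"
    and "digraph_iso (with_proj A) (with_proj B)" "digraph_iso (with_proj B) (with_proj C)"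
  shows "digraph_iso (with_proj A) (with_proj C)"
proof -
  obtain f where f: "bij_betw f (pverts A) (pverts B)"
    "\<forall>u\<in>pverts A. \<forall>v\<in>pverts A. (u, v) \<in> parcs A \<longleftrightarrow> (f u, f v) \<in> parcs B"
    using assms(4) digraph_iso_with_proj_iff[OF assms(1,2)] by auto
  obtain g where g: "bij_betw g (pverts B) (pverts C)"
    "\<forall>u\<in>pverts B. \<forall>v\<in>pverts B. (u, v) \<in> parcs B \<longleftrightarrow> (g u, g v) \<in> parcs C"
    using assms(5) digraph_iso_with_proj_iff[OF assms(2,3)] by auto
  show ?thesis
    unfolding digraph_iso_with_proj_iff[OF assms(1,3)]
    using bij_betw_trans[OF f(1) g(1)] f g(2) bij_betwE[OF f(1)]
    by (intro exI[of _ "g \<circ> f"]) simp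
qed

lemma realizes_imp_realizable:
  fixes G :: "('v, 'e) pre_digraph" and H :: "'a pair_pre_digraph"
  assumes "pair_graph H" and GH: "realizes G H"
  shows "realizable H"
proof -
  interpret H: pair_graph H by fact
  interpret fin_digraph G using GH by (simp add: realizes_def)
  obtain f :: "'v \<Rightarrow> nat" where f: "inj_on f (verts G)"
    using finite_imp_inj_to_nat_seg[OF finite_verts] by blast
  obtain g :: "'e \<Rightarrow> nat" where g: "inj_on g (arcs G)"
    using finite_imp_inj_to_nat_seg[OF finite_arcs] by blast
  define hom where "hom = \<lparr>iso_verts = f, iso_arcs = g,
    iso_head = f \<circ> head G \<circ> the_inv_into (arcs G) g,
    iso_tail = f \<circ> tail G \<circ> the_inv_into (arcs G) g\<rparr>"
  have hom: "digraph_isomorphism hom"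
    using f g wf_digraph by (simp add: digraph_isomorphism_def hom_def the_inv_into_f_f)
  have "realizes (app_iso hom G) H"
    unfolding realizes_def
  proof
    show "fin_digraph (app_iso hom G)"
      using hom by (rule fin_digraphI_app_iso)
    show "digraph_iso (with_proj (hike_dependency_graph (app_iso hom G))) (with_proj H)"
      using digraph_iso_trans_pair[OF pair_wf_digraph_hike pair_wf_digraph_hike
          H.pair_wf_digraph hike_app_iso[OF hom]] GH
      by (simp add: realizes_def)
  qed
  then show ?thesis
    unfolding realizable_def by blast
qed

end

theory Submission
  imports Defs
begin

text \<open>
  The simple cycles of \<open>G\<close> with vertex set \<open>W\<close> correspond to the pairs of a cyclic permutation
  \<open>\<sigma>\<close> of \<open>W\<close> and a choice of one arc from \<open>v\<close> to \<open>\<sigma> v\<close> for every \<open>v \<in> W\<close>, so that the left-hand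
  side of the equation for \<open>W\<close> counts them.  If \<open>G\<close> realizes \<open>H\<close>, the cycles through a given vertex
  of \<open>G\<close> form a clique of \<open>H\<close>, these cliques cover \<open>H\<close>, and the class of \<open>W\<close> is the set of cycles
  with vertex set \<open>W\<close>.  Conversely, if all counts agree, there is a bijection from the simple
  cycles to the vertices of \<open>H\<close> under which the vertex set of a cycle becomes the set of indices of
  the cliques containing its image; two cycles then meet iff their images share a clique, that is,
  iff these are equal or adjacent.
\<close>

section \<open>Cyclic permutations as lists\<close>

text \<open>The hypothesis says that \<open>\<sigma>\<close> sends each entry of \<open>xs\<close>
  to the cyclically next one; this is how cyclic permutations are encoded by lists below. As
  \<open>rotate k\<close> commutes with \<open>map \<sigma>\<close>, the equation iterates.\<close>

lemma map_funpow_eq_rotate: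
  assumes "map \<sigma> xs = rotate1 xs"
  shows "map (\<sigma> ^^ k) xs = rotate k xs"
proof (induction k)
  case (Suc k)
  have "map (\<sigma> ^^ Suc k) xs = map \<sigma> (map (\<sigma> ^^ k) xs)"
    by simp
  also have "\<dots> = rotate k (map \<sigma> xs)"
    by (simp only: Suc.IH rotate_map)
  also have "\<dots> = rotate (Suc k) xs"
    by (simp only: assms rotate1_rotate_swap rotate_Suc)
  finally show ?case .
qed simp

lemma nth_eq_funpow_hd:
  assumes "map \<sigma> xs = rotate1 xs" "k < length xs"
  shows "xs ! k = (\<sigma> ^^ k) (hd xs)"
proof -
  have "xs \<noteq> []"
    using assms(2) by auto
  then have "xs ! k = hd (rotate k xs)"
    using assms(2) by (simp add: hd_rotate_conv_nth)
  also have "\<dots> = (\<sigma> ^^ k) (hd xs)"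
    using \<open>xs \<noteq> []\<close> by (simp add: hd_map flip: map_funpow_eq_rotate[OF assms(1)])
  finally show ?thesis .
qed

lemma finite_Cyc: "finite W \<Longrightarrow> finite (Cyc W)"
  by (rule finite_subset[OF _ finite_permutations[of W]]) (auto simp: Cyc_def)

text \<open>Rotation by the full length is the identity, so the orbit of \<open>hd xs\<close> closes
  up after \<open>length xs\<close> steps; the powers below that bound run through the entries of
  \<open>xs\<close>.\<close>

lemma CycI:
  assumes "\<sigma> permutes set xs" "xs \<noteq> []" "map \<sigma> xs = rotate1 xs"
  shows "\<sigma> \<in> Cyc (set xs)"
proof -
  have "hd xs \<in> set xs"
    using assms(2) by simp
  have "(\<sigma> ^^ length xs) (hd xs) = hd (map (\<sigma> ^^ length xs) xs)"
    using assms(2) by (simp add: hd_map)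
  also have "\<dots> = hd xs"
    by (simp add: map_funpow_eq_rotate[OF assms(3)])
  finally have "orbit \<sigma> (hd xs) = {(\<sigma> ^^ k) (hd xs) | k. k < length xs}"
    using assms(2) by (intro orbit_altdef_bounded) auto
  also have "\<dots> = set xs"
    unfolding set_conv_nth using nth_eq_funpow_hd[OF assms(3)] by metis
  finally show ?thesis
    using assms(1) \<open>hd xs \<in> set xs\<close> by (auto simp: Cyc_def cyclic_on_def)
qed

lemma Cyc_obtain_list:
  assumes "\<sigma> \<in> Cyc W"
  shows "\<exists>xs. xs \<noteq> [] \<and> distinct xs \<and> set xs = W \<and> map \<sigma> xs = rotate1 xs"
proof -
  obtain v where v: "v \<in> W" "W = orbit \<sigma> v"
    using assms by (auto simp: Cyc_def cyclic_on_def)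
  define d where "d = funpow_dist1 \<sigma> v v"
  define xs where "xs = map (\<lambda>k. (\<sigma> ^^ k) v) [0..<d]"
  \<comment> \<open>Orbits use positive powers only, so this says that \<open>v\<close> returns to
    itself; hence the first return time \<open>d\<close> exists, and no finiteness of
    \<open>W\<close> has to be assumed.\<close>
  have self: "v \<in> orbit \<sigma> v"
    using v by simp
  have "d > 0"
    by (simp add: d_def)
  have "map \<sigma> xs = rotate1 xs"
  proof (rule nth_equalityI)
    fix k assume k: "k < length (map \<sigma> xs)"
    show "map \<sigma> xs ! k = rotate1 xs ! k"
    \<comment> \<open>Only at the last index does the successor wrap around, and there it is the
      first return to \<open>v\<close>.\<close>
    proof (cases "Suc k = d")
      case True
      have "(\<sigma> ^^ Suc k) v = v"
        unfolding True d_def using self by (rule funpow_dist1_prop)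
      then have "\<sigma> ((\<sigma> ^^ k) v) = v"
        by simp
      then show ?thesis
        using k \<open>d > 0\<close> by (simp add: nth_rotate1 xs_def True)
    next
      case False
      then show ?thesis
        using k by (simp add: nth_rotate1 xs_def)
    qed
  qed simp
  moreover have "distinct xs"
    using inj_on_funpow_dist1[OF self] unfolding xs_def d_def distinct_map by (simp only: set_upt distinct_upt simp_thms)
  moreover have "set xs = W"
    using orbit_conv_funpow_dist1[OF self] v(2) by (simp only: xs_def d_def set_map set_upt)
  ultimately show ?thesis
    using v(1) by (intro exI[of _ xs]) auto
qed

section \<open>Lists up to rotation\<close>

lemma set_mem_rotations: "q \<in> rotations p \<Longrightarrow> set q = set p"
  by (auto simp: rotations_def)

lemma self_in_rotations: "p \<in> rotations p"
  unfolding rotations_def by (rule range_eqI[of _ _ 0]) simp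

lemma rotations_eq:
  assumes "q \<in> rotations p"
  shows "rotations q = rotations p"
proof -
  obtain k where q: "q = rotate k p"
    using assms by (auto simp: rotations_def)
  have "rotate j p \<in> rotations q" for j
  proof (cases "p = []")
    case False
    let ?n = "length p"
    have "k mod ?n \<le> ?n"
      using False by (simp add: less_imp_le)
    \<comment> \<open>The complement of \<open>k mod ?n\<close> undoes the rotation from
      \<open>p\<close> to \<open>q\<close>; reducing \<open>k\<close> first keeps the subtraction on
      naturals from truncating.\<close>
    have "rotate (j + (?n - k mod ?n)) q = rotate (j + (?n - k mod ?n) + k mod ?n) p"
      unfolding q by (subst rotate_conv_mod[of k]) (simp only: rotate_rotate)
    also have "\<dots> = rotate (j + ?n) p"
      by (simp only: add.assoc le_add_diff_inverse2[OF \<open>k mod ?n \<le> ?n\<close>])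
    also have "\<dots> = rotate j p"
      by (metis mod_add_self2 rotate_conv_mod)
    finally show ?thesis
      unfolding rotations_def by (metis rangeI)
  qed (simp add: q rotations_def)
  then show ?thesis
    by (auto simp: rotations_def q rotate_rotate)
qed

text \<open>A list that follows \<open>\<sigma>\<close> is determined by its head and its length. It
  thus suffices to rotate \<open>xs\<close> until its head is \<open>hd ys\<close>; distinctness
  makes the lengths agree.\<close>

lemma rotations_unique:
  assumes "distinct xs" "distinct ys" "set xs = set ys"
    and "map \<sigma> xs = rotate1 xs" "map \<sigma> ys = rotate1 ys"
  shows "ys \<in> rotations xs"
proof (cases "ys = []")
  case True
  then show ?thesis
    using assms(3) by (simp add: self_in_rotations)
next
  case False
  then have "hd ys \<in> set xs"
    using assms(3) by simp
  then obtain k where k: "k < length xs" "xs ! k = hd ys"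
    by (auto simp: in_set_conv_nth)
  define zs where "zs = rotate k xs"
  have "xs \<noteq> []"
    using k by auto
  then have hd: "hd zs = hd ys"
    using k by (simp add: zs_def hd_rotate_conv_nth)
  have len: "length zs = length ys"
    using assms(1-3) by (simp add: zs_def flip: distinct_card)
  have zs: "map \<sigma> zs = rotate1 zs"
    by (simp add: zs_def assms(4) rotate1_rotate_swap flip: rotate_map)
  have "zs = ys"
    by (rule nth_equalityI)
      (simp_all add: len hd nth_eq_funpow_hd[OF zs] nth_eq_funpow_hd[OF assms(5)])
  then show ?thesis
    by (auto simp: zs_def rotations_def)
qed

section \<open>Counting the simple cycles on a vertex set\<close>

lemma (in pre_digraph) cas_iff:
  "p \<noteq> [] \<Longrightarrow> cas u p v \<longleftrightarrow> u = tail G (hd p) \<and> map (head G) p = tl (map (tail G) p) @ [v]"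
proof (induction p arbitrary: u)
  case (Cons e p)
  then show ?case
    by (cases p) auto
qed simp

text \<open>This removes the base point of the walk and brings cycles into the form of the list
  encoding: the tails are the distinct entries, and the head of each arc is the next tail. The
  vertices of the closed walk after its start are the tails rotated by one.\<close>

lemma (in wf_digraph) cycle_iff:
  "cycle p \<longleftrightarrow> p \<noteq> [] \<and> set p \<subseteq> arcs G \<and> distinct (map (tail G) p) \<and>
    map (head G) p = rotate1 (map (tail G) p)"
proof (cases "p = []")
  case False
  have rot: "rotate1 (map (tail G) p) = tl (map (tail G) p) @ [tail G (hd p)]"
    using False by (cases p) auto
  have cas: "cas u p u \<longleftrightarrow> u = tail G (hd p) \<and> map (head G) p = rotate1 (map (tail G) p)" for u
    unfolding cas_iff[OF False] rot by auto
  have "distinct (tl (awalk_verts u p)) \<longleftrightarrow> distinct (map (tail G) p)" if "cas u p u" for u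
  proof -
    have "tl (awalk_verts u p) = rotate1 (map (tail G) p)"
      using awalk_verts_conv'[OF that] False that by (simp add: cas)
    then show ?thesis
      by (simp only: distinct1_rotate)
  qed
  moreover have "tail G (hd p) \<in> verts G" if "set p \<subseteq> arcs G"
    using that False by (simp add: subset_iff)
  ultimately show ?thesis
    using False unfolding cycle_def awalk_def by (metis cas)
qed (simp add: cycle_def)

lemma cycle_verts_rotations: "cycle_verts G (rotations p) = tail G ` set p"
  using self_in_rotations[of p] by (auto simp: cycle_verts_def dest: set_mem_rotations)

context fin_digraph
begin

definition arc_choices :: "'a set \<Rightarrow> (('a \<Rightarrow> 'a) \<times> ('a \<Rightarrow> 'b)) set" where
  "arc_choices W = (SIGMA \<sigma>:Cyc W. \<Pi>\<^sub>E v\<in>W. {e \<in> arcs G. tail G e = v \<and> head G e = \<sigma> v})"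

lemma finite_arc_choices: "finite W \<Longrightarrow> finite (arc_choices W)"
  unfolding arc_choices_def by (intro finite_SigmaI finite_Cyc finite_PiE) auto

lemma card_arc_choices:
  assumes "finite W"
  shows "card (arc_choices W) = (\<Sum>\<sigma>\<in>Cyc W. \<Prod>v\<in>W. adj_matrix G v (\<sigma> v))"
  unfolding arc_choices_def using assms
  by (subst card_SigmaI) (auto simp: finite_Cyc card_PiE adj_matrix_def intro!: finite_PiE)

lemma bij_arc_choices_simple_cycles:
  "\<exists>\<Phi>. bij_betw \<Phi> (arc_choices W) {C \<in> simple_cycles G. cycle_verts G C = W}"
proof -
  \<comment> \<open>An arbitrary but fixed ordering of \<open>W\<close> along
    \<open>\<sigma>\<close>; the choice of starting point disappears when \<open>\<Phi>\<close>
    passes to rotation classes.\<close>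
  define ord where "ord \<sigma> = (SOME xs. xs \<noteq> [] \<and> distinct xs \<and> set xs = W \<and> map \<sigma> xs = rotate1 xs)"
    for \<sigma> :: "'a \<Rightarrow> 'a"
  define \<Phi> where "\<Phi> = (\<lambda>(\<sigma>, f). rotations (map f (ord \<sigma>)) :: 'b list set)"
  have ord: "ord \<sigma> \<noteq> []" "distinct (ord \<sigma>)" "set (ord \<sigma>) = W" "map \<sigma> (ord \<sigma>) = rotate1 (ord \<sigma>)"
    if "\<sigma> \<in> Cyc W" for \<sigma>
    using someI_ex[OF Cyc_obtain_list[OF that]] by (simp_all add: ord_def)
  have mem: "\<sigma> \<in> Cyc W" "f \<in> extensional W"
    "\<And>v. v \<in> W \<Longrightarrow> f v \<in> arcs G" "\<And>v. v \<in> W \<Longrightarrow> tail G (f v) = v"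
    "\<And>v. v \<in> W \<Longrightarrow> head G (f v) = \<sigma> v"
    if "(\<sigma>, f) \<in> arc_choices W" for \<sigma> f
    using that by (auto simp: arc_choices_def PiE_def Pi_def)
  have tails: "map (tail G) (map f (ord \<sigma>)) = ord \<sigma>"
    and heads: "map (head G) (map f (ord \<sigma>)) = map \<sigma> (ord \<sigma>)"
    if "(\<sigma>, f) \<in> arc_choices W" for \<sigma> f
    using ord(3)[OF mem(1)[OF that]] mem(4,5)[OF that] by (auto intro: map_idI)
  have "inj_on \<Phi> (arc_choices W)"
  proof (rule inj_onI, clarify)
    fix \<sigma> f \<tau> g
    assume f: "(\<sigma>, f) \<in> arc_choices W" and g: "(\<tau>, g) \<in> arc_choices W"
      and eq: "\<Phi> (\<sigma>, f) = \<Phi> (\<tau>, g)"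
    then have "map f (ord \<sigma>) \<in> rotations (map g (ord \<tau>))"
      using self_in_rotations[of "map f (ord \<sigma>)"] by (simp add: \<Phi>_def)
    from set_mem_rotations[OF this] have im: "f ` W = g ` W"
      by (simp only: set_map ord(3)[OF mem(1)[OF f]] ord(3)[OF mem(1)[OF g]])
    \<comment> \<open>The two cycles use the same set of arcs, and the tail of an arc tells at which
      vertex it was chosen.\<close>
    have fg: "f v = g v" if "v \<in> W" for v
    proof -
      have "f v \<in> g ` W"
        unfolding im[symmetric] using that by (rule imageI)
      then obtain w where "f v = g w" "w \<in> W"
        by (rule imageE)
      then show ?thesis
        using mem(4)[OF f that] mem(4)[OF g, of w] by simp
    qed
    then have "f = g"
      using mem(2)[OF f] mem(2)[OF g] by (intro extensionalityI) auto
    moreover have "\<sigma> = \<tau>"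
    proof
      fix v
      show "\<sigma> v = \<tau> v"
        using mem(1)[OF f] mem(1)[OF g] mem(5)[OF f, of v] mem(5)[OF g, of v] fg[of v]
        by (cases "v \<in> W") (auto simp: Cyc_def permutes_not_in)
    qed
    ultimately show "\<sigma> = \<tau> \<and> f = g"
      by simp
  qed
  moreover have "\<Phi> (\<sigma>, f) \<in> simple_cycles G" "cycle_verts G (\<Phi> (\<sigma>, f)) = W"
    if "(\<sigma>, f) \<in> arc_choices W" for \<sigma> f
  proof -
    note \<sigma> = mem(1)[OF that]
    have "cycle (map f (ord \<sigma>))"
      unfolding cycle_iff tails[OF that] heads[OF that]
      using ord[OF \<sigma>] mem(3)[OF that] by auto
    then show "\<Phi> (\<sigma>, f) \<in> simple_cycles G"
      by (auto simp: \<Phi>_def simple_cycles_def)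
    show "cycle_verts G (\<Phi> (\<sigma>, f)) = W"
      using tails[OF that, THEN arg_cong[of _ _ set]] ord(3)[OF \<sigma>]
      by (simp add: \<Phi>_def cycle_verts_rotations image_image)
  qed
  moreover have "C \<in> \<Phi> ` arc_choices W" if C_mem: "C \<in> simple_cycles G" and C_verts: "cycle_verts G C = W" for C
  proof -
    obtain p where C: "C = rotations p" and p: "cycle p"
      using C_mem by (auto simp: simple_cycles_def)
    have W: "W = tail G ` set p"
      using C_verts by (simp add: C cycle_verts_rotations)
    from p have p': "p \<noteq> []" "set p \<subseteq> arcs G" "distinct (map (tail G) p)"
      "map (head G) p = rotate1 (map (tail G) p)"
      by (simp_all add: cycle_iff)
    have inj: "inj_on (tail G) (set p)"
      using p'(3) by (simp add: distinct_map)
    \<comment> \<open>Surjectivity: the arcs of a cycle have distinct tails, so the arc leaving a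
      vertex is recovered by inverting \<open>tail G\<close>. Restricting to \<open>W\<close> makes
      \<open>f\<close> extensional, as \<open>arc_choices\<close> demands.\<close>
    define f where "f = restrict (the_inv_into (set p) (tail G)) W"
    have f_tail: "f (tail G e) = e" if "e \<in> set p" for e
      using that inj by (simp add: f_def W the_inv_into_f_f)
    define \<sigma> where "\<sigma> v = (if v \<in> W then head G (f v) else v)" for v
    have \<sigma>_tail: "\<sigma> (tail G e) = head G e" if "e \<in> set p" for e
      using that by (simp add: \<sigma>_def f_tail W)
    have map_\<sigma>: "map \<sigma> (map (tail G) p) = rotate1 (map (tail G) p)"
      unfolding p'(4)[symmetric] by (simp add: \<sigma>_tail)
    \<comment> \<open>Rotation preserves the set of entries, so \<open>\<sigma>\<close> maps
      \<open>W\<close> onto itself; finiteness then yields injectivity.\<close>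
    have "\<sigma> ` W = W"
      using arg_cong[OF map_\<sigma>, of set] by (simp add: W image_image)
    moreover have "finite W"
      by (simp add: W)
    ultimately have "bij_betw \<sigma> W W"
      by (simp add: bij_betw_def eq_card_imp_inj_on)
    then have "\<sigma> permutes W"
      by (rule bij_imp_permutes) (simp add: \<sigma>_def)
    then have \<sigma>: "\<sigma> \<in> Cyc W"
      using CycI[of \<sigma> "map (tail G) p"] map_\<sigma> p'(1) by (simp add: W)
    have mem: "(\<sigma>, f) \<in> arc_choices W"
      unfolding arc_choices_def using \<sigma> p'(2)
      by (auto simp: W f_tail \<sigma>_tail f_def PiE_def subset_iff the_inv_into_f_f[OF inj])
    \<comment> \<open>Both lists run through \<open>W\<close> along \<open>\<sigma>\<close>;
      applying \<open>f\<close> turns this rotation of vertices into one of arcs.\<close>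
    have "map (tail G) p \<in> rotations (ord \<sigma>)"
      using ord[OF \<sigma>] p' map_\<sigma> W by (intro rotations_unique[of _ _ \<sigma>]) auto
    then have "map f (map (tail G) p) \<in> rotations (map f (ord \<sigma>))"
      unfolding rotations_map by (rule imageI)
    moreover have "map f (map (tail G) p) = p"
      by (auto simp: f_tail intro: map_idI)
    ultimately have "p \<in> rotations (map f (ord \<sigma>))"
      by (simp only:)
    from rotations_eq[OF this] have "\<Phi> (\<sigma>, f) = C"
      by (simp add: \<Phi>_def C)
    then show ?thesis
      using mem by blast
  qed
  ultimately show ?thesis
    by (intro exI[of _ \<Phi>]) (auto simp: bij_betw_def)
qed

lemma card_simple_cycles_on:
  assumes "finite W"
  shows "card {C \<in> simple_cycles G. cycle_verts G C = W} =
    (\<Sum>\<sigma>\<in>Cyc W. \<Prod>v\<in>W. adj_matrix G v (\<sigma> v))"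
  using bij_arc_choices_simple_cycles[of W] card_arc_choices[OF assms]
  by (metis bij_betw_same_card)

text \<open>The vertex set of a cycle is one of finitely many subsets of \<open>verts G\<close>, and
  each subset carries only finitely many cycles because it has finitely many arc choices.\<close>

lemma finite_simple_cycles: "finite (simple_cycles G)"
proof -
  have "finite {C \<in> simple_cycles G. cycle_verts G C = W}" if "W \<in> Pow (verts G)" for W
    using bij_arc_choices_simple_cycles[of W] finite_arc_choices[of W] that finite_verts
    by (metis PowD bij_betw_finite finite_subset)
  then have "finite (\<Union>W\<in>Pow (verts G). {C \<in> simple_cycles G. cycle_verts G C = W})"
    by (intro finite_UN_I) simp_all
  then show ?thesis
    by (rule finite_subset[rotated]) (use cycle_verts_in_verts in blast)
qed

end

lemma cycle_verts_nonempty: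
  assumes "C \<in> simple_cycles G"
  shows "cycle_verts G C \<noteq> {}"
  using assms by (auto simp: simple_cycles_def cycle_verts_rotations pre_digraph.cycle_def)

section \<open>Realizability\<close>

lemma realizes_iff:
  assumes "pair_graph H"
  shows "realizes G H \<longleftrightarrow> fin_digraph G \<and>
    (\<exists>f. bij_betw f (simple_cycles G) (pverts H) \<and>
      (\<forall>C\<in>simple_cycles G. \<forall>D\<in>simple_cycles G.
        C \<noteq> D \<and> cycle_verts G C \<inter> cycle_verts G D \<noteq> {} \<longleftrightarrow> (f C, f D) \<in> parcs H))"
proof -
  interpret pair_graph H by fact
  show ?thesis
    unfolding realizes_def digraph_iso_with_proj_iff[OF pair_wf_digraph_hike pair_wf_digraph]
    by (simp add: hike_dependency_graph_def)
qed

lemma realizes_app_iso: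
  assumes "pair_graph H" "realizes G H" "pre_digraph.digraph_isomorphism G hom"
  shows "realizes (app_iso hom G) H"
proof -
  interpret H: pair_graph H by fact
  interpret fin_digraph G
    using assms(2) by (simp add: realizes_def)
  show ?thesis
    using assms(2) fin_digraphI_app_iso[OF assms(3)] hike_app_iso[OF assms(3)]
      digraph_iso_trans_pair[OF pair_wf_digraph_hike pair_wf_digraph_hike H.pair_wf_digraph]
    unfolding realizes_def by blast
qed

text \<open>The system is indexed by an initial segment, whereas \<open>realizable\<close> admits
  any finite set of naturals as vertices; renaming the vertices and keeping the arcs bridges
  this.\<close>

lemma realizable_obtain_atLeastAtMost:
  assumes "pair_graph H" "realizable H"
  obtains n and G :: "(nat, nat) pre_digraph" where "realizes G H" "verts G = {1..n}"
proof -
  obtain G :: "(nat, nat) pre_digraph" where G: "realizes G H"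
    using assms(2) by (auto simp: realizable_def)
  interpret fin_digraph G
    using G by (simp add: realizes_def)
  obtain f where f: "bij_betw f (verts G) {1..card (verts G)}"
    using finite_same_card_bij[OF finite_verts, of "{1..card (verts G)}"] by auto
  define hom where "hom = \<lparr>iso_verts = f, iso_arcs = id, iso_head = f \<circ> head G, iso_tail = f \<circ> tail G\<rparr>"
  have "digraph_isomorphism hom"
    using f wf_digraph by (simp add: digraph_isomorphism_def hom_def bij_betw_def)
  then have "realizes (app_iso hom G) H"
    using realizes_app_iso assms(1) G by blast
  moreover have "verts (app_iso hom G) = {1..card (verts G)}"
    using f by (simp add: hom_def bij_betw_def)
  ultimately show thesis
    by (rule that)
qed

section \<open>From a realization to a solution\<close>

lemma realizes_imp_solution:
  assumes H: "pair_graph H" and G: "realizes G H" and verts: "verts G = {1..n}"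
  shows "\<exists>\<kappa>. clique_cover H n \<kappa> \<and> cycle_system_solution H n \<kappa> (adj_matrix G)"
proof -
  interpret fin_digraph G
    using G by (simp add: realizes_def)
  obtain f where f: "bij_betw f (simple_cycles G) (pverts H)"
    and adj: "\<And>C D. C \<in> simple_cycles G \<Longrightarrow> D \<in> simple_cycles G \<Longrightarrow>
      C \<noteq> D \<and> cycle_verts G C \<inter> cycle_verts G D \<noteq> {} \<longleftrightarrow> (f C, f D) \<in> parcs H"
    using iffD1[OF realizes_iff[OF H] G] by (elim conjE exE) (rule that, auto)
  have inj: "inj_on f (simple_cycles G)" and im: "pverts H = f ` simple_cycles G"
    using f by (auto simp: bij_betw_def)
  define \<kappa> where "\<kappa> i = f ` {C \<in> simple_cycles G. i \<in> cycle_verts G C}" for i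
  have f_mem_\<kappa>: "f C \<in> \<kappa> i \<longleftrightarrow> i \<in> cycle_verts G C" if "C \<in> simple_cycles G" for C i
    using that inj by (auto simp: \<kappa>_def inj_on_eq_iff)
  have sub: "cycle_verts G C \<subseteq> {1..n}" if "C \<in> simple_cycles G" for C
    using cycle_verts_in_verts[OF that] verts by simp
  have "clique H (\<kappa> i)" for i
    unfolding clique_def \<kappa>_def im using adj by blast
  moreover have "\<exists>i\<in>{1..n}. u \<in> \<kappa> i" if "u \<in> pverts H" for u
    using that cycle_verts_nonempty sub f_mem_\<kappa> unfolding im by blast
  moreover have "\<exists>i\<in>{1..n}. u \<in> \<kappa> i \<and> v \<in> \<kappa> i" if uv: "(u, v) \<in> parcs H" for u v
  proof -
    interpret H: pair_graph H by fact
    obtain C D where CD: "C \<in> simple_cycles G" "D \<in> simple_cycles G" "u = f C" "v = f D"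
      using H.in_arcsD1[OF uv] H.in_arcsD2[OF uv] unfolding im by blast
    then obtain i where "i \<in> cycle_verts G C" "i \<in> cycle_verts G D"
      using adj uv by blast
    then show ?thesis
      using CD sub f_mem_\<kappa> by blast
  qed
  ultimately have "clique_cover H n \<kappa>"
    unfolding clique_cover_def by blast
  moreover have "clique_class H n \<kappa> W = f ` {C \<in> simple_cycles G. cycle_verts G C = W}"
    if "W \<subseteq> {1..n}" for W
  proof -
    \<comment> \<open>The indices of the cliques containing \<open>f C\<close> are exactly the
      vertices of \<open>C\<close>, all in \<open>{1..n}\<close>. The case of empty \<open>W\<close>
      needs no separate treatment.\<close>
    have "f C \<in> clique_class H n \<kappa> W \<longleftrightarrow> cycle_verts G C = W" if C: "C \<in> simple_cycles G" for C
      using sub[OF C] \<open>W \<subseteq> {1..n}\<close> C by (auto simp: clique_class_def im f_mem_\<kappa>)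
    moreover have "clique_class H n \<kappa> W \<subseteq> f ` simple_cycles G"
      by (auto simp: clique_class_def im)
    ultimately show ?thesis
      by blast
  qed
  then have "cycle_system_solution H n \<kappa> (adj_matrix G)"
    unfolding cycle_system_solution_def
    by (auto simp: card_image inj_on_subset[OF inj] card_simple_cycles_on finite_subset)
  ultimately show ?thesis
    by blast
qed

section \<open>From a solution to a realization\<close>

lemma ex_bij_betw_fibrewise:
  assumes "finite A" "finite B"
    and card: "\<And>y. card {a \<in> A. f a = y} = card {b \<in> B. g b = y}"
  shows "\<exists>h. bij_betw h A B \<and> (\<forall>a\<in>A. g (h a) = f a)"
proof -
  have "\<exists>h. bij_betw h {a \<in> A. f a = y} {b \<in> B. g b = y}" for y
    using assms by (intro finite_same_card_bij) auto
  then obtain h where h: "\<And>y. bij_betw (h y) {a \<in> A. f a = y} {b \<in> B. g b = y}"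
    by metis
  \<comment> \<open>Glues the bijections of the fibres: each element is mapped by the one belonging
    to its own fibre.\<close>
  define k where "k a = h (f a) a" for a
  have k: "k a \<in> B" "g (k a) = f a" if "a \<in> A" for a
    using bij_betwE[OF h[of "f a"]] that by (auto simp: k_def)
  have "inj_on k A"
  proof (rule inj_onI)
    fix a b assume ab: "a \<in> A" "b \<in> A" "k a = k b"
    then have "f a = f b"
      using k(2) by metis
    then show "a = b"
      using ab bij_betw_imp_inj_on[OF h[of "f a"]] by (auto simp: k_def inj_on_def)
  qed
  moreover have "b \<in> k ` A" if "b \<in> B" for b
  proof -
    have "b \<in> h (g b) ` {a \<in> A. f a = g b}"
      using bij_betw_imp_surj_on[OF h[of "g b"]] that by simp
    then obtain a where "a \<in> A" "f a = g b" "b = h (g b) a"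
      by blast
    then show ?thesis
      by (intro image_eqI[of _ _ a]) (simp_all add: k_def)
  qed
  ultimately have "bij_betw k A B"
    using k(1) by (auto simp: bij_betw_def)
  then show ?thesis
    using k(2) by blast
qed

lemma solution_imp_realizes:
  assumes H: "pair_graph H" and cover: "clique_cover H n \<kappa>" and sol: "cycle_system_solution H n \<kappa> m"
    and G: "fin_digraph G" and verts: "verts G = {1..n}"
    and m: "\<And>i j. i \<in> {1..n} \<Longrightarrow> j \<in> {1..n} \<Longrightarrow> adj_matrix G i j = m i j"
  shows "realizes G H"
proof -
  interpret fin_digraph G by fact
  interpret H: pair_graph H by fact
  \<comment> \<open>The vertex set that a cycle corresponding to \<open>u\<close> must have. The
    class of \<open>W\<close> is the fibre of \<open>idx\<close> over \<open>W\<close>, so the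
    system equates the fibre sizes of \<open>cycle_verts G\<close> and \<open>idx\<close>.\<close>
  define idx where "idx u = {i \<in> {1..n}. u \<in> \<kappa> i}" for u
  have sub: "cycle_verts G C \<subseteq> {1..n}" if "C \<in> simple_cycles G" for C
    using cycle_verts_in_verts[OF that] verts by simp
  have "card {C \<in> simple_cycles G. cycle_verts G C = W} = card {u \<in> pverts H. idx u = W}" for W
  proof (cases "W \<subseteq> {1..n}")
    case True
    have "card {C \<in> simple_cycles G. cycle_verts G C = W} =
        (\<Sum>\<sigma>\<in>Cyc W. \<Prod>v\<in>W. adj_matrix G v (\<sigma> v))"
      using True by (intro card_simple_cycles_on) (rule finite_subset, auto)
    also have "\<dots> = (\<Sum>\<sigma>\<in>Cyc W. \<Prod>v\<in>W. m v (\<sigma> v))"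
    proof (intro sum.cong prod.cong refl m)
      fix \<sigma> v assume "\<sigma> \<in> Cyc W" "v \<in> W"
      then have "\<sigma> v \<in> W"
        by (simp add: Cyc_def permutes_in_image)
      then show "v \<in> {1..n}" "\<sigma> v \<in> {1..n}"
        using True \<open>v \<in> W\<close> by auto
    qed
    also have "\<dots> = card (clique_class H n \<kappa> W)"
      using sol True by (simp add: cycle_system_solution_def)
    also have "clique_class H n \<kappa> W = {u \<in> pverts H. idx u = W}"
      using True by (auto simp: clique_class_def idx_def)
    finally show ?thesis .
  next
    case False
    \<comment> \<open>The fibrewise lemma asks for every \<open>W\<close>; outside the subsets of
      \<open>{1..n}\<close> both fibres are empty.\<close>
    then have "{C \<in> simple_cycles G. cycle_verts G C = W} = {}" "{u \<in> pverts H. idx u = W} = {}"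
      using sub by (auto simp: idx_def)
    then show ?thesis
      by (simp only: card.empty)
  qed
  from ex_bij_betw_fibrewise[OF finite_simple_cycles H.pair_finite_verts this]
  obtain h where h: "bij_betw h (simple_cycles G) (pverts H)"
    and idx: "\<And>C. C \<in> simple_cycles G \<Longrightarrow> idx (h C) = cycle_verts G C"
    by blast
  \<comment> \<open>Left to right, a shared clique makes distinct vertices adjacent. Right to left,
    the cover contains each edge in some clique, and \<open>H\<close> has no loops.\<close>
  have adj: "u \<noteq> v \<and> idx u \<inter> idx v \<noteq> {} \<longleftrightarrow> (u, v) \<in> parcs H" for u v
  proof
    assume "u \<noteq> v \<and> idx u \<inter> idx v \<noteq> {}"
    then show "(u, v) \<in> parcs H"
      using cover by (auto simp: clique_cover_def clique_def idx_def)
  next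
    assume "(u, v) \<in> parcs H"
    then show "u \<noteq> v \<and> idx u \<inter> idx v \<noteq> {}"
      using cover H.pair_no_loops[of "(u, v)"] by (fastforce simp: clique_cover_def idx_def)
  qed
  have "C \<noteq> D \<and> cycle_verts G C \<inter> cycle_verts G D \<noteq> {} \<longleftrightarrow> (h C, h D) \<in> parcs H"
    if "C \<in> simple_cycles G" "D \<in> simple_cycles G" for C D
    using that adj[of "h C" "h D"] idx bij_betw_imp_inj_on[OF h] by (auto simp: inj_on_eq_iff)
  then show ?thesis
    unfolding realizes_iff[OF H] using G h by blast
qed

theorem theorem1:
  fixes H :: "'a pair_pre_digraph"
  assumes "pair_graph H"
  shows "(realizable H \<longleftrightarrow>
            (\<exists>n \<kappa>. clique_cover H n \<kappa> \<and> (\<exists>m. cycle_system_solution H n \<kappa> m))) \<and>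
         (\<forall>n \<kappa> m. clique_cover H n \<kappa> \<and> cycle_system_solution H n \<kappa> m \<longrightarrow>
            (\<forall>G :: (nat, 'e) pre_digraph.
               fin_digraph G \<and> verts G = {1..n} \<and>
               (\<forall>i\<in>{1..n}. \<forall>j\<in>{1..n}. adj_matrix G i j = m i j) \<longrightarrow>
               realizes G H))"
proof (intro conjI iffI allI impI)
  assume "realizable H"
  then show "\<exists>n \<kappa>. clique_cover H n \<kappa> \<and> (\<exists>m. cycle_system_solution H n \<kappa> m)"
    using realizable_obtain_atLeastAtMost realizes_imp_solution assms by metis
next
  assume "\<exists>n \<kappa>. clique_cover H n \<kappa> \<and> (\<exists>m. cycle_system_solution H n \<kappa> m)"
  then obtain n \<kappa> m where "clique_cover H n \<kappa>" "cycle_system_solution H n \<kappa> m"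
    by blast
  \<comment> \<open>The arcs of this witness are triples of an arc's ends and a counter;
    \<open>realizes_imp_realizable\<close> renames them to naturals afterwards.\<close>
  moreover obtain G :: "(nat, nat \<times> nat \<times> nat) pre_digraph" where "fin_digraph G" "verts G = {1..n}"
    "\<forall>i\<in>{1..n}. \<forall>j\<in>{1..n}. adj_matrix G i j = m i j"
    using ex_digraph_adj_matrix by blast
  ultimately have "realizes G H"
    using solution_imp_realizes[OF assms] by blast
  then show "realizable H"
    using realizes_imp_realizable[OF assms] by blast
next
  fix n \<kappa> m and G :: "(nat, 'e) pre_digraph"
  assume "clique_cover H n \<kappa> \<and> cycle_system_solution H n \<kappa> m"
    and "fin_digraph G \<and> verts G = {1..n} \<and> (\<forall>i\<in>{1..n}. \<forall>j\<in>{1..n}. adj_matrix G i j = m i j)"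
  then show "realizes G H"
    using solution_imp_realizes[OF assms] by blast
qed

end
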